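(* Let $\mathcal{X}$ be a standard Borel space, let $Q_0$ be a probability distribution on $\mathcal{X}$, let $T:\mathcal{X}\to\mathbb{R}$ be a (measurable) function, and let $P(\cdot\mid x)$ be a probability kernel from $\mathcal{X}$ to $\mathcal{X}$. Suppose that $P$ is a forward--backward probability kernel relative to $Q_0$. Let $m\ge 1$ be an integer, let $X\sim Q_0$, let $X_1,\dots,X_m$ be, conditionally on $X$, i.i.d. draws from $P(\cdot\mid X)$, and define \[p_m=\frac{1+\sum_{i=1}^m \mathbf{1}\{T(X_i)\ge T(X)\}}{m+1}.\] Then \[\mathbb{P}\{p_m\le\alpha\}\le 2\alpha\quad\text{for all }\alpha\in[0,1].\]
   Context: A probability kernel $P$ from $\mathcal{X}$ to $\mathcal{X}$ is called a \emph{forward--backward probability kernel relative to $Q_0$} if the following holds: if $X\sim Q_0$ and $X'\mid X\sim P(\cdot\mid X)$, then there exists a random variable $Y$ (taking values in some measurable space, defined jointly with $(X,X')$, possibly on an enlarged probability space) such that $X$ and $X'$ are conditionally i.i.d. given $Y$. *)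

theory Defs
  imports "HOL-Probability.Probability"
begin

definition standard_borel :: "'a measure \<Rightarrow> bool" where
  "standard_borel S \<longleftrightarrow>
     (\<exists>\<tau>. completely_metrizable_space \<tau> \<and> separable_space \<tau> \<and>
          space S = topspace \<tau> \<and> sets S = sigma_sets (topspace \<tau>) {U. openin \<tau> U})"

text \<open>
  A version of the conditional probability of the event \<open>E\<close> given the random element
  \<open>Y\<close> with values in \<open>N\<close>, i.e. given the sigma-algebra generated by \<open>Y\<close>.
\<close>

definition cond_probability ::
  "'w measure \<Rightarrow> ('w \<Rightarrow> 'y) \<Rightarrow> 'y measure \<Rightarrow> 'w set \<Rightarrow> 'w \<Rightarrow> real" where
  "cond_probability M Y N E = real_cond_exp M (vimage_algebra (space M) Y N) (indicator E)"

definition cond_law ::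
  "'w measure \<Rightarrow> ('w \<Rightarrow> 'y) \<Rightarrow> 'y measure \<Rightarrow> ('w \<Rightarrow> 'a) \<Rightarrow> 'a measure \<Rightarrow> ('y \<Rightarrow> 'a measure) \<Rightarrow> bool" where
  "cond_law M Y N Z S K \<longleftrightarrow>
     Y \<in> measurable M N \<and> Z \<in> measurable M S \<and> K \<in> measurable N (prob_algebra S) \<and>
     (\<forall>A\<in>sets S. AE w in M.
        cond_probability M Y N {w \<in> space M. Z w \<in> A} w = measure (K (Y w)) A)"

definition cond_iid ::
  "'w measure \<Rightarrow> ('w \<Rightarrow> 'y) \<Rightarrow> 'y measure \<Rightarrow> ('i \<Rightarrow> 'w \<Rightarrow> 'a) \<Rightarrow> 'a measure \<Rightarrow> 'i set \<Rightarrow> bool" where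
  "cond_iid M Y N Z S I \<longleftrightarrow>
     Y \<in> measurable M N \<and> (\<forall>i\<in>I. Z i \<in> measurable M S) \<and>
     (\<forall>i\<in>I. \<forall>j\<in>I. \<forall>A\<in>sets S. AE w in M.
        cond_probability M Y N {w \<in> space M. Z i w \<in> A} w =
        cond_probability M Y N {w \<in> space M. Z j w \<in> A} w) \<and>
     (\<forall>J\<subseteq>I. finite J \<longrightarrow> (\<forall>A. (\<forall>j\<in>J. A j \<in> sets S) \<longrightarrow>
        (AE w in M.
           cond_probability M Y N {w \<in> space M. \<forall>j\<in>J. Z j w \<in> A j} w =
           (\<Prod>j\<in>J. cond_probability M Y N {w \<in> space M. Z j w \<in> A j} w))))"

text \<open>
  Only the joint law of \<open>(X, X')\<close> is prescribed, so the sample space may be enlarged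
  at will to carry \<open>Y\<close>. As HOL cannot quantify existentially over types, the
  types of the sample space and of the values of \<open>Y\<close> are parameters; in a theorem that
  assumes this predicate they are type variables, so the witnesses may live in arbitrary types.
\<close>

definition forward_backward_kernel ::
  "'w itself \<Rightarrow> 'y itself \<Rightarrow> 'a measure \<Rightarrow> 'a measure \<Rightarrow> ('a \<Rightarrow> 'a measure) \<Rightarrow> bool" where
  "forward_backward_kernel _ _ S Q0 P \<longleftrightarrow>
     (\<exists>(M :: 'w measure) X X' (Y :: 'w \<Rightarrow> 'y) N.
        prob_space M \<and> X \<in> measurable M S \<and> distr M S X = Q0 \<and> cond_law M X S X' S P \<and>
        cond_iid M Y N (case_bool X X') S UNIV)"

definition mc_pvalue ::
  "('a \<Rightarrow> real) \<Rightarrow> nat \<Rightarrow> ('w \<Rightarrow> 'a) \<Rightarrow> (nat \<Rightarrow> 'w \<Rightarrow> 'a) \<Rightarrow> 'w \<Rightarrow> real" where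
  "mc_pvalue T m X Xs w =
     (1 + (\<Sum>i=1..m. of_bool (T (Xs i w) \<ge> T (X w)))) / (real m + 1)"

end

theory Submission
  imports Defs
begin

text \<open>
  Let \<open>g x\<close> be the \<open>P x\<close>-probability of \<open>{y. T y \<ge> T x}\<close>, and let \<open>A = {x. g x \<le> t}\<close>. For
  \<open>X\<close>, \<open>X'\<close> conditionally i.i.d. given \<open>Y\<close>, Jensen's inequality for the conditional probability of
  \<open>A\<close> given \<open>Y\<close> yields \<open>Q0(A)\<^sup>2 \<le> Pr(X \<in> A, X' \<in> A)\<close>. By exchangeability the right-hand side is at
  most \<open>2 Pr(X \<in> A, X' \<in> A, T X' \<ge> T X) \<le> 2 t Q0(A)\<close>, so \<open>Q0(A) \<le> 2 t\<close>.

  Given \<open>X\<close>, the number of draws with \<open>T(X\<^sub>i) \<ge> T(X)\<close> is binomial with success probability \<open>g X\<close>, so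
  the event \<open>p\<^sub>m \<le> \<alpha>\<close> has probability \<open>E h(g X)\<close>, where \<open>h p = Pr(Bin(m, p) < k)\<close> and
  \<open>k = \<lfloor>\<alpha> (m + 1)\<rfloor>\<close>. As \<open>h\<close> is antitone, the bound on the law of \<open>g X\<close> gives
  \<open>E h(g X) \<le> 2 \<integral>\<^sub>0\<^sup>1 h = 2 k / (m + 1) \<le> 2 \<alpha>\<close>.
\<close>

subsection \<open>Conditional probabilities and conditional product laws\<close>

lemma subalgebra_vimage_algebra:
  assumes "Y \<in> measurable M N"
  shows "subalgebra M (vimage_algebra (space M) Y N)"
  using assms by (auto simp: subalgebra_def sets_vimage_algebra2 measurable_space intro: measurable_sets)

text \<open>This is the averaging property that characterises conditional expectation. It turns
  almost-everywhere facts about conditional probabilities into facts about probabilities: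
  \<open>f = 1\<close> gives total probability, and an indicator depending on the conditioning
  element gives joint laws.\<close>

lemma integral_mult_cond_probability:
  fixes f :: "'w \<Rightarrow> real"
  assumes "prob_space M" and Y: "Y \<in> measurable M N" and E: "E \<in> sets M"
    and f: "f \<in> borel_measurable (vimage_algebra (space M) Y N)"
    and int: "integrable M (\<lambda>w. f w * indicator E w)"
  shows "(\<integral>w. f w * cond_probability M Y N E w \<partial>M) = (\<integral>w. f w * indicator E w \<partial>M)"
proof -
  interpret prob_space M by fact
  interpret finite_measure_subalgebra M "vimage_algebra (space M) Y N"
    by unfold_locales (rule subalgebra_vimage_algebra[OF Y])
  show "(\<integral>w. f w * cond_probability M Y N E w \<partial>M) = (\<integral>w. f w * indicator E w \<partial>M)"
    unfolding cond_probability_def using real_cond_exp_intg(2)[OF int f] E by simp_all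
qed

text \<open>Conditional expectation preserves the bounds 0 and 1 of an indicator. They make a
  conditional probability and its square integrable in the variance argument.\<close>

lemma cond_probability_bounds:
  assumes "prob_space M" and Y: "Y \<in> measurable M N" and E: "E \<in> sets M"
  shows "AE w in M. 0 \<le> cond_probability M Y N E w \<and> cond_probability M Y N E w \<le> 1"
proof -
  interpret prob_space M by fact
  interpret finite_measure_subalgebra M "vimage_algebra (space M) Y N"
    by unfold_locales (rule subalgebra_vimage_algebra[OF Y])
  have i: "integrable M (indicator E :: _ \<Rightarrow> real)" using E by (simp add: integrable_indicator_iff less_top[symmetric])
  have "AE w in M. 0 \<le> cond_probability M Y N E w" "AE w in M. cond_probability M Y N E w \<le> 1"
    unfolding cond_probability_def
    using real_cond_exp_ge_c[OF i, of 0] real_cond_exp_le_c[OF i, of 1] by (auto simp: indicator_def)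
  then show ?thesis by auto
qed

lemma cond_probability_measurable [measurable]:
  "cond_probability M Y N E \<in> borel_measurable (vimage_algebra (space M) Y N)"
  "cond_probability M Y N E \<in> borel_measurable M"
  by (auto simp: cond_probability_def)

text \<open>It suffices to test an intersection-stable generator. On a box with sides
  \<open>E i\<close>, the product measure is a finite product of the functions
  \<open>emeasure (P x) (E i)\<close>, each measurable in \<open>x\<close>.\<close>

lemma measurable_PiM_prob_algebra:
  assumes I: "finite I" and P: "P \<in> measurable S (prob_algebra R)"
  shows "(\<lambda>x. PiM I (\<lambda>_. P x)) \<in> measurable S (prob_algebra (PiM I (\<lambda>_. R)))"
proof (rule measurable_prob_algebra_generated[OF sets_PiM Int_stable_prod_algebra prod_algebra_sets_into_space])
  fix x assume x: "x \<in> space S"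
  have Px: "prob_space (P x)" "sets (P x) = sets R"
    using measurable_space[OF P x] by (auto simp: space_prob_algebra)
  then show "prob_space (PiM I (\<lambda>_. P x))" by (intro prob_space_PiM)
  show "sets (PiM I (\<lambda>_. P x)) = sets (PiM I (\<lambda>_. R))" by (rule sets_PiM_cong) (auto simp: Px)
next
  fix A assume "A \<in> prod_algebra I (\<lambda>_. R)"
  then obtain E where A: "A = Pi\<^sub>E I E" and E: "E \<in> (\<Pi> i\<in>I. sets R)" by (rule prod_algebraE_all)
  have eq: "emeasure (PiM I (\<lambda>_. P x)) A = (\<Prod>i\<in>I. emeasure (P x) (E i))" if x: "x \<in> space S" for x
  proof -
    have Px: "prob_space (P x)" "sets (P x) = sets R"
      using measurable_space[OF P x] by (auto simp: space_prob_algebra)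
    interpret product_prob_space "\<lambda>_. P x" I by (intro product_prob_spaceI Px)
    show ?thesis using E Px unfolding A by (subst emeasure_PiM) (auto simp: I)
  qed
  have "(\<lambda>x. emeasure (P x) (E i)) \<in> borel_measurable S" if "i \<in> I" for i
    using measurable_compose[OF measurable_prob_algebraD[OF P] measurable_emeasure_subprob_algebra] E that by auto
  then have "(\<lambda>x. \<Prod>i\<in>I. emeasure (P x) (E i)) \<in> borel_measurable S"
    by (intro borel_measurable_prod_ennreal)
  then show "(\<lambda>x. emeasure (PiM I (\<lambda>_. P x)) A) \<in> borel_measurable S"
    by (subst measurable_cong[OF eq])
qed

text \<open>For each box, \<open>law\<close> holds outside a null set that may depend on the box.
  Integration removes these null sets, so both measures agree on products of a measurable set with a
  box. Such products form an intersection-stable generator, hence the measures coincide.\<close>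

lemma distr_Pair_eq_bind_PiM:
  assumes M: "prob_space M" and I: "finite I"
    and X: "X \<in> measurable M S" and Z: "\<And>i. i \<in> I \<Longrightarrow> Z i \<in> measurable M R"
    and P: "P \<in> measurable S (prob_algebra R)"
    and law: "\<And>A. (\<And>i. i \<in> I \<Longrightarrow> A i \<in> sets R) \<Longrightarrow>
      AE w in M. cond_probability M X S {w \<in> space M. \<forall>i\<in>I. Z i w \<in> A i} w =
                 (\<Prod>i\<in>I. measure (P (X w)) (A i))"
  shows "distr M (S \<Otimes>\<^sub>M PiM I (\<lambda>_. R)) (\<lambda>w. (X w, \<lambda>i\<in>I. Z i w)) =
    Giry_Monad.bind (distr M S X) (\<lambda>x. distr (PiM I (\<lambda>_. P x)) (S \<Otimes>\<^sub>M PiM I (\<lambda>_. R)) (Pair x))"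
    (is "?L = Giry_Monad.bind ?Q ?K")
proof -
  interpret prob_space M by fact
  let ?N = "S \<Otimes>\<^sub>M PiM I (\<lambda>_. R)"
  let ?E = "{a \<times> b |a b. a \<in> sets S \<and> b \<in> prod_algebra I (\<lambda>_. R)}"
  have K: "?K \<in> measurable S (prob_algebra ?N)"
    by (rule measurable_distr_prob_space2[OF measurable_PiM_prob_algebra[OF I P]]) simp
  have Q: "?Q \<in> space (prob_algebra S)"
    using X by (auto simp: space_prob_algebra intro!: prob_space_distr)
  have XZ: "(\<lambda>w. (X w, \<lambda>i\<in>I. Z i w)) \<in> measurable M ?N"
    by (intro measurable_Pair X measurable_restrict Z)
  interpret L: prob_space ?L by (rule prob_space_distr[OF XZ])
  \<comment> \<open>The second factors range over boxes only, because these are the sets about which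
    \<open>law\<close> gives information.\<close>
  have N: "sets ?N = sigma_sets (space S \<times> space (PiM I (\<lambda>_. R))) ?E"
  proof -
    have "sets ?N = sets (sigma (space S \<times> space (PiM I (\<lambda>_. R))) ?E)"
      by (rule sets_pair_eq[where Ca="{space S}" and Cb="{space (PiM I (\<lambda>_. R))}"])
        (auto simp: sets.space_closed sets.sigma_sets_eq sets_PiM space_PiM I
          intro!: prod_algebraI_finite dest: prod_algebra_sets_into_space[THEN subsetD])
    also have "\<dots> = sigma_sets (space S \<times> space (PiM I (\<lambda>_. R))) ?E"
      by (rule sets_measure_of)
        (use sets.sets_into_space prod_algebra_sets_into_space in \<open>fastforce simp: space_PiM\<close>)
    finally show ?thesis .
  qed
  have PX: "prob_space (P (X w))" "sets (P (X w)) = sets R" if "w \<in> space M" for w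
    using measurable_space[OF P measurable_space[OF X that]] by (auto simp: space_prob_algebra)
  show ?thesis
  proof (rule measure_eqI_generator_eq[where E="?E" and A="\<lambda>_. space S \<times> space (PiM I (\<lambda>_. R))"
        and \<Omega>="space S \<times> space (PiM I (\<lambda>_. R))"])
    show "Int_stable ?E"
    proof (rule Int_stableI)
      fix x y assume "x \<in> ?E" "y \<in> ?E"
      then obtain a b c d where "x = a \<times> b" "y = c \<times> d" "a \<in> sets S" "c \<in> sets S"
        "b \<in> prod_algebra I (\<lambda>_. R)" "d \<in> prod_algebra I (\<lambda>_. R)" by auto
      then show "x \<inter> y \<in> ?E"
        using Int_stable_prod_algebra[of I "\<lambda>_. R"]
        by (auto simp: Int_stable_def Times_Int_Times intro!: exI[of _ "a \<inter> c"] exI[of _ "b \<inter> d"])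
    qed
    show "?E \<subseteq> Pow (space S \<times> space (PiM I (\<lambda>_. R)))"
      using sets.sets_into_space prod_algebra_sets_into_space by (fastforce simp: space_PiM)
    show "sets ?L = sigma_sets (space S \<times> space (PiM I (\<lambda>_. R))) ?E" using N by simp
    show "sets (Giry_Monad.bind ?Q ?K) = sigma_sets (space S \<times> space (PiM I (\<lambda>_. R))) ?E"
      using sets_bind'[OF Q K] N by simp
    show "range (\<lambda>_. space S \<times> space (PiM I (\<lambda>_. R))) \<subseteq> ?E"
      by (auto simp: space_PiM I intro!: prod_algebraI_finite exI[of _ "space S"])
    show "emeasure ?L (space S \<times> space (PiM I (\<lambda>_. R))) \<noteq> \<infinity>" for i :: nat by simp
  next
    fix C assume "C \<in> ?E"
    then obtain a F where C: "C = a \<times> Pi\<^sub>E I F" and a: "a \<in> sets S" and F: "\<And>i. i \<in> I \<Longrightarrow> F i \<in> sets R"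
      by (auto elim!: prod_algebraE_all)
    have CN: "C \<in> sets ?N" unfolding C using a F I by (intro pair_measureI sets_PiM_I_finite) auto
    let ?D = "{w \<in> space M. \<forall>i\<in>I. Z i w \<in> F i}"
    have D: "?D \<in> sets M"
      by (intro sets.sets_Collect_finite_All I) (use Z F in \<open>auto intro: measurable_sets_Collect\<close>) 
    have phi_meas: "(\<lambda>w. indicator a (X w) * (\<Prod>i\<in>I. measure (P (X w)) (F i))) \<in> borel_measurable M"
      using measurable_compose[OF measurable_compose[OF X P] measurable_measure_prob_algebra[OF F]] a X
      by (intro borel_measurable_times borel_measurable_prod) auto
    have "emeasure ?L C = emeasure M ({w \<in> space M. X w \<in> a} \<inter> ?D)"
      by (subst emeasure_distr[OF XZ CN]) (auto simp: C PiE_iff intro!: arg_cong[where f="emeasure M"])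
    also have "\<dots> = ennreal (\<integral>w. indicator a (X w) * indicator ?D w \<partial>M)"
    proof -
      have "(\<integral>w. indicator a (X w) * (indicator ?D w :: real) \<partial>M) =
        (\<integral>w. indicator ({w \<in> space M. X w \<in> a} \<inter> ?D) w \<partial>M)"
        by (intro Bochner_Integration.integral_cong) (auto simp: indicator_def)
      also have "\<dots> = measure M ({w \<in> space M. X w \<in> a} \<inter> ?D)"
        using D measurable_sets_Collect[OF X] a by (simp add: Int_absorb2 sets.sets_into_space)
      finally show ?thesis by (simp add: emeasure_eq_measure)
    qed
    \<comment> \<open>The factor \<open>indicator a (X w)\<close> is measurable for the
      sigma-algebra generated by \<open>X\<close>, so under the integral the event \<open>?D\<close>
      may be replaced by its conditional probability.\<close>
    also have "(\<integral>w. indicator a (X w) * (indicator ?D w :: real) \<partial>M) =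
      (\<integral>w. indicator a (X w) * cond_probability M X S ?D w \<partial>M)"
    proof (rule integral_mult_cond_probability[OF M X D, symmetric])
      show "(\<lambda>w. indicator a (X w)) \<in> borel_measurable (vimage_algebra (space M) X S)"
        using a X by (intro measurable_compose[OF measurable_vimage_algebra1 borel_measurable_indicator])
          (auto dest: measurable_space)
      show "integrable M (\<lambda>w. indicator a (X w) * indicator ?D w :: real)"
        using D a X by (intro integrable_const_bound[where B=1]) (auto simp: indicator_def)
    qed
    \<comment> \<open>The exceptional null set belonging to the box \<open>F\<close> disappears
      under the integral.\<close>
    also have "\<dots> = (\<integral>w. indicator a (X w) * (\<Prod>i\<in>I. measure (P (X w)) (F i)) \<partial>M)"
    proof (rule integral_cong_AE)
      show "(\<lambda>w. indicator a (X w) * (\<Prod>i\<in>I. measure (P (X w)) (F i))) \<in> borel_measurable M"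
        using phi_meas .
    qed (use law[of F, OF F] a X in auto)
    also have "ennreal \<dots> = (\<integral>\<^sup>+w. ennreal (indicator a (X w) * (\<Prod>i\<in>I. measure (P (X w)) (F i))) \<partial>M)"
    proof (rule nn_integral_eq_integral[symmetric])
      show "integrable M (\<lambda>w. indicator a (X w) * (\<Prod>i\<in>I. measure (P (X w)) (F i)))"
      proof (rule integrable_const_bound[where B=1])
        show "AE w in M. norm (indicator a (X w) * (\<Prod>i\<in>I. measure (P (X w)) (F i))) \<le> 1"
        proof (rule AE_I2)
          fix w assume "w \<in> space M"
          then have "prob_space (P (X w))" using PX by auto
          then have "(\<Prod>i\<in>I. measure (P (X w)) (F i)) \<le> 1"
            by (intro prod_le_1) (auto intro: prob_space.prob_le_1)
          then show "norm (indicator a (X w) * (\<Prod>i\<in>I. measure (P (X w)) (F i))) \<le> 1"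
            by (auto simp: indicator_def prod_nonneg abs_mult abs_prod)
        qed
      qed (rule phi_meas)
    qed (auto intro!: prod_nonneg mult_nonneg_nonneg)
    also have "\<dots> = (\<integral>\<^sup>+w. emeasure (?K (X w)) C \<partial>M)"
    proof (rule nn_integral_cong)
      fix w assume w: "w \<in> space M"
      interpret product_prob_space "\<lambda>_. P (X w)" I using PX[OF w] by (intro product_prob_spaceI) auto
      have PairX: "Pair (X w) \<in> measurable (PiM I (\<lambda>_. P (X w))) ?N"
        using measurable_Pair1'[OF measurable_space[OF X w]] sets_PiM_cong[OF refl, of I "\<lambda>_. P (X w)" "\<lambda>_. R"] PX[OF w]
        by (simp cong: measurable_cong_sets)
      have FP: "F i \<in> sets (P (X w))" if "i \<in> I" for i using F PX[OF w] that by simp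
      have "Pi\<^sub>E I F \<subseteq> space (PiM I (\<lambda>_. P (X w)))"
        unfolding space_PiM by (intro PiE_mono sets.sets_into_space FP)
      then have "Pair (X w) -` C \<inter> space (PiM I (\<lambda>_. P (X w))) = (if X w \<in> a then Pi\<^sub>E I F else {})"
        by (auto simp: C)
      then have "emeasure (?K (X w)) C = emeasure (PiM I (\<lambda>_. P (X w))) (if X w \<in> a then Pi\<^sub>E I F else {})"
        by (simp add: emeasure_distr[OF PairX CN])
      also have "\<dots> = ennreal (indicator a (X w) * (\<Prod>i\<in>I. measure (P (X w)) (F i)))"
        using FP by (simp add: emeasure_PiM I M.emeasure_eq_measure prod_ennreal)
      finally show "ennreal (indicator a (X w) * (\<Prod>i\<in>I. measure (P (X w)) (F i))) = emeasure (?K (X w)) C" ..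
    qed
    also have "\<dots> = emeasure (Giry_Monad.bind ?Q ?K) C"
      using measurable_compose[OF measurable_prob_algebraD[OF K] measurable_emeasure_subprob_algebra[OF CN]]
      by (subst emeasure_bind_prob_algebra[OF Q K CN]) (simp add: nn_integral_distr[OF X])
    finally show "emeasure ?L C = emeasure (Giry_Monad.bind ?Q ?K) C" .
  qed (auto)
qed

text \<open>The sets in \<open>law\<close> are fixed, whereas here the condition on
  \<open>Z i\<close> may vary with \<open>X\<close>, as in a comparison of \<open>T\<close> at the
  two points. The joint law handles this: once \<open>X\<close> is fixed at \<open>x\<close>, the
  event is the box whose sides are the sections of the sets \<open>B i\<close> at
  \<open>x\<close>.\<close>

lemma emeasure_cond_product:
  assumes M: "prob_space M" and I: "finite I"
    and X: "X \<in> measurable M S" and Z: "\<And>i. i \<in> I \<Longrightarrow> Z i \<in> measurable M R"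
    and P: "P \<in> measurable S (prob_algebra R)"
    and law: "\<And>A. (\<And>i. i \<in> I \<Longrightarrow> A i \<in> sets R) \<Longrightarrow>
      AE w in M. cond_probability M X S {w \<in> space M. \<forall>i\<in>I. Z i w \<in> A i} w =
                 (\<Prod>i\<in>I. measure (P (X w)) (A i))"
    and B: "\<And>i. i \<in> I \<Longrightarrow> B i \<in> sets (S \<Otimes>\<^sub>M R)"
  shows "emeasure M {w \<in> space M. \<forall>i\<in>I. (X w, Z i w) \<in> B i} =
    (\<integral>\<^sup>+w. (\<Prod>i\<in>I. emeasure (P (X w)) (Pair (X w) -` B i)) \<partial>M)"
proof -
  let ?N = "S \<Otimes>\<^sub>M PiM I (\<lambda>_. R)"
  let ?K = "\<lambda>x. distr (PiM I (\<lambda>_. P x)) ?N (Pair x)"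
  let ?C = "{z \<in> space ?N. \<forall>i\<in>I. (fst z, snd z i) \<in> B i}"
  have C: "?C \<in> sets ?N"
  proof (rule sets.sets_Collect_finite_All[OF _ I])
    fix i assume i: "i \<in> I"
    have "(\<lambda>z. (fst z, snd z i)) \<in> measurable ?N (S \<Otimes>\<^sub>M R)"
      using i by (intro measurable_Pair measurable_fst measurable_compose[OF measurable_snd measurable_component_singleton])
    then show "{z \<in> space ?N. (fst z, snd z i) \<in> B i} \<in> sets ?N"
      by (rule measurable_sets_Collect) (use B i in auto)
  qed
  have XZ: "(\<lambda>w. (X w, \<lambda>i\<in>I. Z i w)) \<in> measurable M ?N"
    by (intro measurable_Pair X measurable_restrict Z)
  have Q: "distr M S X \<in> space (prob_algebra S)"
    using X M by (auto simp: space_prob_algebra intro!: prob_space.prob_space_distr)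
  have K: "?K \<in> measurable S (prob_algebra ?N)"
    by (rule measurable_distr_prob_space2[OF measurable_PiM_prob_algebra[OF I P]]) simp
  have joint: "distr M ?N (\<lambda>w. (X w, \<lambda>i\<in>I. Z i w)) = Giry_Monad.bind (distr M S X) ?K"
    by (intro distr_Pair_eq_bind_PiM M I X Z P law)
  have "emeasure M {w \<in> space M. \<forall>i\<in>I. (X w, Z i w) \<in> B i} =
      emeasure (distr M ?N (\<lambda>w. (X w, \<lambda>i\<in>I. Z i w))) ?C"
    using measurable_space[OF XZ]
    by (subst emeasure_distr[OF XZ C]) (auto intro!: arg_cong[where f="emeasure M"])
  also have "\<dots> = (\<integral>\<^sup>+x. emeasure (?K x) ?C \<partial>distr M S X)"
    unfolding joint by (rule emeasure_bind_prob_algebra[OF Q K C])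
  also have "\<dots> = (\<integral>\<^sup>+w. emeasure (?K (X w)) ?C \<partial>M)"
    using measurable_compose[OF measurable_prob_algebraD[OF K] measurable_emeasure_subprob_algebra[OF C]]
    by (simp add: nn_integral_distr[OF X])
  also have "\<dots> = (\<integral>\<^sup>+w. (\<Prod>i\<in>I. emeasure (P (X w)) (Pair (X w) -` B i)) \<partial>M)"
  proof (rule nn_integral_cong)
    fix w assume w: "w \<in> space M"
    have PX: "prob_space (P (X w))" "sets (P (X w)) = sets R"
      using measurable_space[OF P measurable_space[OF X w]] by (auto simp: space_prob_algebra)
    interpret product_prob_space "\<lambda>_. P (X w)" I using PX by (intro product_prob_spaceI) auto
    have PairX: "Pair (X w) \<in> measurable (PiM I (\<lambda>_. P (X w))) ?N"
      using measurable_Pair1'[OF measurable_space[OF X w]] sets_PiM_cong[OF refl, of I "\<lambda>_. P (X w)" "\<lambda>_. R"] PX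
      by (simp cong: measurable_cong_sets)
    have BP: "Pair (X w) -` B i \<in> sets (P (X w))" if "i \<in> I" for i
      using sets_Pair1[OF B[OF that]] PX by simp
    have sub: "Pi\<^sub>E I (\<lambda>i. Pair (X w) -` B i) \<subseteq> space (PiM I (\<lambda>_. P (X w)))"
      unfolding space_PiM by (intro PiE_mono sets.sets_into_space BP)
    from sub have "Pi\<^sub>E I (\<lambda>i. Pair (X w) -` B i) \<subseteq> Pair (X w) -` space ?N"
      using measurable_space[OF PairX] by blast
    then have "Pair (X w) -` ?C \<inter> space (PiM I (\<lambda>_. P (X w))) = Pi\<^sub>E I (\<lambda>i. Pair (X w) -` B i)"
      using sub by (auto simp: space_PiM PiE_iff)
    then show "emeasure (?K (X w)) ?C = (\<Prod>i\<in>I. emeasure (P (X w)) (Pair (X w) -` B i))"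
      using BP by (simp add: emeasure_distr[OF PairX C] emeasure_PiM I)
  qed
  finally show ?thesis .
qed

subsection \<open>Tail bound for forward--backward kernels\<close>

text \<open>Conditional independence gives a product, equality of the conditional laws replaces
  \<open>X'\<close> by \<open>X\<close> in it, and averaging removes the conditioning. The resulting
  integral is symmetric in \<open>A\<close> and \<open>B\<close> and a second moment for
  \<open>A = B\<close>; the next two results about pairs exploit these features.\<close>

lemma measure_cond_iid_pair:
  assumes M: "prob_space M" and iid: "cond_iid M Y N (case_bool X X') S UNIV"
    and A: "A \<in> sets S" and B: "B \<in> sets S"
  shows "measure M {w \<in> space M. X w \<in> A \<and> X' w \<in> B} =
    (\<integral>w. cond_probability M Y N {w \<in> space M. X w \<in> A} w *
         cond_probability M Y N {w \<in> space M. X w \<in> B} w \<partial>M)"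
proof -
  interpret prob_space M by fact
  let ?c = "cond_probability M Y N"
  have Y: "Y \<in> measurable M N" and X: "X \<in> measurable M S" and X': "X' \<in> measurable M S"
    using iid by (auto simp: cond_iid_def all_bool_eq)
  have id: "AE w in M. ?c {w \<in> space M. X w \<in> B} w = ?c {w \<in> space M. X' w \<in> B} w"
  proof -
    have "\<forall>i j. \<forall>A\<in>sets S. AE w in M. ?c {w \<in> space M. case_bool X X' i w \<in> A} w =
        ?c {w \<in> space M. case_bool X X' j w \<in> A} w"
      using iid by (simp add: cond_iid_def)
    from this[THEN spec[of _ True], THEN spec[of _ False], THEN bspec[OF _ B]] show ?thesis by simp
  qed
  let ?E = "{w \<in> space M. X w \<in> A \<and> X' w \<in> B}"
  have E: "?E \<in> sets M" using X X' A B by measurable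
  \<comment> \<open>The product formula is taken at the full Boolean index set, with
    \<open>A\<close> attached to \<open>True\<close> and \<open>B\<close> to
    \<open>False\<close>.\<close>
  have prod: "AE w in M. ?c {w \<in> space M. \<forall>j\<in>UNIV. case_bool X X' j w \<in> case_bool A B j} w =
      (\<Prod>j\<in>UNIV. ?c {w \<in> space M. case_bool X X' j w \<in> case_bool A B j} w)"
    by (rule iid[unfolded cond_iid_def, THEN conjunct2, THEN conjunct2, THEN conjunct2,
          THEN spec[of _ UNIV], THEN mp, OF subset_UNIV, THEN mp, OF finite, THEN spec, THEN mp])
      (use A B in \<open>simp split: bool.split\<close>)
  have "AE w in M. ?c ?E w = ?c {w \<in> space M. X w \<in> A} w * ?c {w \<in> space M. X' w \<in> B} w"
  proof -
    have "{w \<in> space M. \<forall>j\<in>UNIV. case_bool X X' j w \<in> case_bool A B j} = ?E"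
      by (auto simp: all_bool_eq)
    with prod show ?thesis by (simp add: UNIV_bool mult.commute)
  qed
  with id have ae: "AE w in M. ?c ?E w = ?c {w \<in> space M. X w \<in> A} w * ?c {w \<in> space M. X w \<in> B} w"
    by eventually_elim simp
  \<comment> \<open>The constant 1 serves as the test function in the averaging property.\<close>
  have "measure M ?E = (\<integral>w. 1 * indicator ?E w \<partial>M)" using E by simp
  also have "\<dots> = (\<integral>w. 1 * ?c ?E w \<partial>M)"
    by (rule integral_mult_cond_probability[OF M Y E, symmetric])
      (use E in \<open>auto simp: integrable_indicator_iff less_top[symmetric]\<close>)
  also have "\<dots> = (\<integral>w. ?c {w \<in> space M. X w \<in> A} w * ?c {w \<in> space M. X w \<in> B} w \<partial>M)"
    by (rule integral_cong_AE) (use ae in auto)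
  finally show ?thesis .
qed

text \<open>The integral formula for pairs is symmetric in its two sets, so the laws of
  \<open>(X, X')\<close> and \<open>(X', X)\<close> agree on rectangles, an intersection-stable
  generator.\<close>

lemma measure_cond_iid_swap:
  assumes M: "prob_space M" and iid: "cond_iid M Y N (case_bool X X') S UNIV"
    and C: "C \<in> sets (S \<Otimes>\<^sub>M S)"
  shows "measure M {w \<in> space M. (X w, X' w) \<in> C} = measure M {w \<in> space M. (X' w, X w) \<in> C}"
proof -
  interpret prob_space M by fact
  have X: "X \<in> measurable M S" and X': "X' \<in> measurable M S"
    using iid by (auto simp: cond_iid_def all_bool_eq)
  have m: "(\<lambda>w. (X w, X' w)) \<in> measurable M (S \<Otimes>\<^sub>M S)" "(\<lambda>w. (X' w, X w)) \<in> measurable M (S \<Otimes>\<^sub>M S)"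
    using X X' by simp_all
  let ?E = "{a \<times> b |a b. a \<in> sets S \<and> b \<in> sets S}"
  have "distr M (S \<Otimes>\<^sub>M S) (\<lambda>w. (X w, X' w)) = distr M (S \<Otimes>\<^sub>M S) (\<lambda>w. (X' w, X w))"
  proof (rule measure_eqI_generator_eq[OF Int_stable_pair_measure_generator[of S S],
        where A="\<lambda>_. space S \<times> space S" and \<Omega>="space S \<times> space S"])
    fix D assume "D \<in> ?E"
    then obtain a b where D: "D = a \<times> b" and ab: "a \<in> sets S" "b \<in> sets S" by auto
    have "measure M {w \<in> space M. X w \<in> a \<and> X' w \<in> b} = measure M {w \<in> space M. X w \<in> b \<and> X' w \<in> a}"
      unfolding measure_cond_iid_pair[OF M iid ab] measure_cond_iid_pair[OF M iid ab(2,1)]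
      by (simp add: mult.commute)
    moreover have "(\<lambda>w. (X w, X' w)) -` D \<inter> space M = {w \<in> space M. X w \<in> a \<and> X' w \<in> b}"
      "(\<lambda>w. (X' w, X w)) -` D \<inter> space M = {w \<in> space M. X w \<in> b \<and> X' w \<in> a}"
      by (auto simp: D)
    ultimately show "emeasure (distr M (S \<Otimes>\<^sub>M S) (\<lambda>w. (X w, X' w))) D =
        emeasure (distr M (S \<Otimes>\<^sub>M S) (\<lambda>w. (X' w, X w))) D"
      using ab m by (simp add: D emeasure_distr emeasure_eq_measure)
  next
    show "emeasure (distr M (S \<Otimes>\<^sub>M S) (\<lambda>w. (X w, X' w))) (space S \<times> space S) \<noteq> \<infinity>" for i :: nat
      using m by (simp add: emeasure_distr)
  qed (auto simp: sets_pair_measure dest: sets.sets_into_space)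
  then have "measure (distr M (S \<Otimes>\<^sub>M S) (\<lambda>w. (X w, X' w))) C =
      measure (distr M (S \<Otimes>\<^sub>M S) (\<lambda>w. (X' w, X w))) C" by simp
  then show ?thesis using m C by (simp add: measure_distr vimage_def Int_def conj_commute)
qed

text \<open>The right-hand side is the second moment of the conditional probability of
  \<open>X w \<in> A\<close> given \<open>Y\<close>, and the left-hand side is the square of its
  mean. Their difference is a variance.\<close>

lemma measure_cond_iid_ge_square:
  assumes M: "prob_space M" and iid: "cond_iid M Y N (case_bool X X') S UNIV" and A: "A \<in> sets S"
  shows "(measure M {w \<in> space M. X w \<in> A})\<^sup>2 \<le> measure M {w \<in> space M. X w \<in> A \<and> X' w \<in> A}"
proof -
  interpret prob_space M by fact
  let ?E = "{w \<in> space M. X w \<in> A}" and ?c = "cond_probability M Y N {w \<in> space M. X w \<in> A}"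
  have Y: "Y \<in> measurable M N" and X: "X \<in> measurable M S"
    using iid by (auto simp: cond_iid_def all_bool_eq)
  have E: "?E \<in> sets M" using X A by measurable
  have "measure M ?E = (\<integral>w. 1 * indicator ?E w \<partial>M)" using E by simp
  also have "\<dots> = (\<integral>w. 1 * ?c w \<partial>M)"
    by (rule integral_mult_cond_probability[OF M Y E, symmetric])
      (use E in \<open>auto simp: integrable_indicator_iff less_top[symmetric]\<close>)
  finally have eq: "expectation ?c = measure M ?E" by simp
  have ae: "AE w in M. 0 \<le> ?c w \<and> ?c w \<le> 1" by (rule cond_probability_bounds[OF M Y E])
  have i: "integrable M ?c" by (rule integrable_const_bound[where B=1]) (use ae in auto)
  have i2: "integrable M (\<lambda>w. (?c w)\<^sup>2)"
    by (rule integrable_const_bound[where B=1]) (use ae in \<open>auto simp: power_le_one\<close>)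
  have "0 \<le> variance ?c" by (rule variance_positive)
  also have "variance ?c = expectation (\<lambda>w. (?c w)\<^sup>2) - (expectation ?c)\<^sup>2" by (rule variance_eq[OF i i2])
  finally show ?thesis
    by (simp add: eq measure_cond_iid_pair[OF M iid A A] power2_eq_square)
qed

lemma measurable_tail_probability:
  fixes T :: "'a \<Rightarrow> real"
  assumes T: "T \<in> borel_measurable S" and P: "P \<in> measurable S (prob_algebra S)"
  shows "(\<lambda>x. measure (P x) {y \<in> space S. T x \<le> T y}) \<in> borel_measurable S"
proof (rule measure_measurable_prob_algebra2[OF _ P])
  have "{z \<in> space (S \<Otimes>\<^sub>M S). T (fst z) \<le> T (snd z)} \<in> sets (S \<Otimes>\<^sub>M S)" using T by measurable
  also have "{z \<in> space (S \<Otimes>\<^sub>M S). T (fst z) \<le> T (snd z)} = (SIGMA x:space S. {y \<in> space S. T x \<le> T y})"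
    by (auto simp: space_pair_measure)
  finally show "(SIGMA x:space S. {y \<in> space S. T x \<le> T y}) \<in> sets (S \<Otimes>\<^sub>M S)" .
qed

text \<open>The factor 2 comes from covering \<open>?A \<times> ?A\<close> by the pairs with
  \<open>T x \<le> T y\<close> and their mirror images. The kernel bounds the first part by
  \<open>t * ?q\<close>, exchangeability gives the same bound for the second, and
  \<open>?q\<^sup>2\<close> is at most their sum.\<close>

lemma forward_backward_tail_bound:
  fixes T :: "'a \<Rightarrow> real" and P :: "'a \<Rightarrow> 'a measure"
  assumes FB: "forward_backward_kernel TYPE('w) TYPE('y) S Q0 P"
    and T: "T \<in> borel_measurable S" and P: "P \<in> measurable S (prob_algebra S)" and t: "0 \<le> t"
  shows "measure Q0 {x \<in> space S. measure (P x) {y \<in> space S. T x \<le> T y} \<le> t} \<le> 2 * t"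
proof -
  obtain M :: "'w measure" and X X' and Y :: "'w \<Rightarrow> 'y" and N where
    M: "prob_space M" and X: "X \<in> measurable M S" and Q0: "distr M S X = Q0"
    and law: "cond_law M X S X' S P" and iid: "cond_iid M Y N (case_bool X X') S UNIV"
    using FB unfolding forward_backward_kernel_def by blast
  interpret prob_space M by fact
  have X': "X' \<in> measurable M S" using law by (simp add: cond_law_def)
  let ?g = "\<lambda>x. measure (P x) {y \<in> space S. T x \<le> T y}"
  let ?A = "{x \<in> space S. ?g x \<le> t}"
  let ?U = "{z \<in> space (S \<Otimes>\<^sub>M S). T (fst z) \<le> T (snd z)}"
  have U: "?U \<in> sets (S \<Otimes>\<^sub>M S)" using T by measurable
  have "?g \<in> borel_measurable S" by (rule measurable_tail_probability[OF T P])
  then have A: "?A \<in> sets S" by measurable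
  \<comment> \<open>With a free second coordinate, the section at a point of \<open>?A\<close> is
    its whole tail set, of kernel probability at most \<open>t\<close>. Confining both coordinates
    to \<open>?A\<close> gives the half of the square to which the swap applies.\<close>
  have B: "(?A \<times> space S) \<inter> ?U \<in> sets (S \<Otimes>\<^sub>M S)" "(?A \<times> ?A) \<inter> ?U \<in> sets (S \<Otimes>\<^sub>M S)"
    using A U by auto
  let ?q = "measure M {w \<in> space M. X w \<in> ?A}"
  have EA: "{w \<in> space M. X w \<in> ?A} \<in> sets M" by (rule predE[OF pred_sets2[OF A X]])
  have XX: "(\<lambda>w. (X w, X' w)) \<in> measurable M (S \<Otimes>\<^sub>M S)" "(\<lambda>w. (X' w, X w)) \<in> measurable M (S \<Otimes>\<^sub>M S)"
    using X X' by simp_all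
  \<comment> \<open>A one-element index set specialises the product formula to a single
    draw.\<close>
  have "emeasure M {w \<in> space M. \<forall>i\<in>{()}. (X w, X' w) \<in> (?A \<times> space S) \<inter> ?U} =
    (\<integral>\<^sup>+w. (\<Prod>i\<in>{()}. emeasure (P (X w)) (Pair (X w) -` ((?A \<times> space S) \<inter> ?U))) \<partial>M)"
    by (rule emeasure_cond_product[OF M _ X X' P _ B(1)]) (use law in \<open>auto simp: cond_law_def\<close>)
  also have "\<dots> \<le> (\<integral>\<^sup>+w. ennreal t * indicator {w \<in> space M. X w \<in> ?A} w \<partial>M)"
  proof (rule nn_integral_mono)
    fix w assume w: "w \<in> space M"
    have "prob_space (P (X w))" using measurable_space[OF P measurable_space[OF X w]] by (auto simp: space_prob_algebra)
    then interpret P: prob_space "P (X w)" .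
    have "Pair (X w) -` ((?A \<times> space S) \<inter> ?U) = (if X w \<in> ?A then {y \<in> space S. T (X w) \<le> T y} else {})"
      by (auto simp: space_pair_measure)
    then show "(\<Prod>i\<in>{()}. emeasure (P (X w)) (Pair (X w) -` ((?A \<times> space S) \<inter> ?U)))
        \<le> ennreal t * indicator {w \<in> space M. X w \<in> ?A} w"
      using w t by (auto simp: P.emeasure_eq_measure)
  qed
  also have "\<dots> = ennreal (t * ?q)"
    using EA t by (simp add: nn_integral_cmult emeasure_eq_measure ennreal_mult)
  finally have "measure M {w \<in> space M. (X w, X' w) \<in> (?A \<times> space S) \<inter> ?U} \<le> t * ?q"
    using t by (simp add: emeasure_eq_measure del: Int_iff mem_Sigma_iff)
  moreover have "measure M {w \<in> space M. (X w, X' w) \<in> (?A \<times> ?A) \<inter> ?U} \<le>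
      measure M {w \<in> space M. (X w, X' w) \<in> (?A \<times> space S) \<inter> ?U}"
    by (intro finite_measure_mono predE[OF pred_sets2[OF B(1) XX(1)]]) auto
  ultimately have le: "measure M {w \<in> space M. (X w, X' w) \<in> (?A \<times> ?A) \<inter> ?U} \<le> t * ?q" by linarith
  have "?q\<^sup>2 \<le> measure M {w \<in> space M. X w \<in> ?A \<and> X' w \<in> ?A}"
    by (rule measure_cond_iid_ge_square[OF M iid A])
  \<comment> \<open>The order on the reals is total, so \<open>T (X w) \<le> T (X' w)\<close> or the
    reverse inequality holds.\<close>
  also have "\<dots> \<le> measure M ({w \<in> space M. (X w, X' w) \<in> (?A \<times> ?A) \<inter> ?U} \<union>
      {w \<in> space M. (X' w, X w) \<in> (?A \<times> ?A) \<inter> ?U})"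
    using measurable_space[OF X] measurable_space[OF X']
    by (intro finite_measure_mono sets.Un predE[OF pred_sets2[OF B(2) XX(1)]] predE[OF pred_sets2[OF B(2) XX(2)]])
      (auto simp: space_pair_measure)
  also have "\<dots> \<le> measure M {w \<in> space M. (X w, X' w) \<in> (?A \<times> ?A) \<inter> ?U} +
      measure M {w \<in> space M. (X' w, X w) \<in> (?A \<times> ?A) \<inter> ?U}"
    by (intro measure_Un_le predE[OF pred_sets2[OF B(2) XX(1)]] predE[OF pred_sets2[OF B(2) XX(2)]])
  also have "\<dots> = 2 * measure M {w \<in> space M. (X w, X' w) \<in> (?A \<times> ?A) \<inter> ?U}"
    using measure_cond_iid_swap[OF M iid B(2)] by linarith
  finally have "?q * ?q \<le> (2 * t) * ?q" using le by (simp add: power2_eq_square)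
  \<comment> \<open>A positive \<open>?q\<close> cancels; for \<open>?q = 0\<close> the claim is
    \<open>0 \<le> t\<close>.\<close>
  then have "?q \<le> 2 * t"
    using t by (cases "?q = 0") (auto simp: mult_le_cancel_right dest: less_le_trans[OF zero_less_measure_iff[THEN iffD2]])
  moreover have "measure Q0 ?A = ?q"
    unfolding Q0[symmetric] using X A by (simp add: measure_distr vimage_def Int_def conj_commute)
  ultimately show ?thesis by simp
qed

subsection \<open>Bernstein polynomials and integration over superlevel sets\<close>

text \<open>The sum is the probability that a binomial variable is below \<open>k\<close>, and its
  derivative telescopes: each Bernstein polynomial contributes two terms, one cancelling what has
  accumulated and the other, by binomial absorption, being the next value. At \<open>k = 0\<close>
  the truncated exponent \<open>k - 1\<close> is harmless because of the factor
  \<open>k\<close>.\<close>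

lemma has_real_derivative_sum_Bernstein:
  "((\<lambda>p. \<Sum>j<k. Bernstein n j p) has_real_derivative
    - (real k * real (n choose k) * p ^ (k - 1) * (1 - p) ^ (n - k))) (at p)"
proof (induction k)
  case (Suc k)
  have absorb: "real (Suc k) * real (n choose Suc k) = real (n choose k) * real (n - k)"
    using binomial_absorb_comp[of n k] binomial_absorption[of k n]
    by (metis mult.commute of_nat_mult)
  have "((\<lambda>p. Bernstein n k p) has_real_derivative
      real (n choose k) * (real k * p ^ (k - 1) * (1 - p) ^ (n - k) -
        real (n - k) * p ^ k * (1 - p) ^ (n - k - 1))) (at p)"
    unfolding Bernstein_def by (auto intro!: derivative_eq_intros simp: algebra_simps)
  from DERIV_add[OF Suc.IH this] show ?case
    unfolding absorb by (simp add: algebra_simps)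
qed simp

lemma sum_Bernstein_antimono:
  assumes "0 \<le> p" "p \<le> q" "q \<le> 1"
  shows "(\<Sum>j<k. Bernstein n j q) \<le> (\<Sum>j<k. Bernstein n j p)"
proof (rule DERIV_nonpos_imp_nonincreasing[OF \<open>p \<le> q\<close>])
  fix x assume "p \<le> x" "x \<le> q"
  with assms have "- (real k * real (n choose k) * x ^ (k - 1) * (1 - x) ^ (n - k)) \<le> 0" by simp
  then show "\<exists>y. ((\<lambda>p. \<Sum>j<k. Bernstein n j p) has_real_derivative y) (at x) \<and> y \<le> 0"
    using has_real_derivative_sum_Bernstein by blast
qed

lemma borel_measurable_Bernstein [measurable]: "Bernstein n k \<in> borel_measurable borel"
  unfolding Bernstein_def[abs_def] by measurable

text \<open>The derivative formula at \<open>Suc n\<close> and \<open>Suc k\<close> exhibits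
  \<open>- (n + 1)\<close> times the integrand, which yields the antiderivative \<open>?F\<close>.
  The binomial tail inside it falls from 1 at \<open>p = 0\<close> to 0 at
  \<open>p = 1\<close>.\<close>

lemma nn_integral_Bernstein:
  assumes "k \<le> n"
  shows "(\<integral>\<^sup>+p. ennreal (Bernstein n k p) * indicator {0..1} p \<partial>lborel) = ennreal (1 / (real n + 1))"
proof -
  let ?F = "\<lambda>p. - (\<Sum>j<Suc k. Bernstein (Suc n) j p) / (real n + 1)"
  have absorb: "real (Suc k) * real (Suc n choose Suc k) = (real n + 1) * real (n choose k)"
    using Suc_times_binomial[of k n] by (metis of_nat_Suc of_nat_mult add.commute)
  have *: "(\<integral>\<^sup>+p. ennreal (Bernstein n k p) * indicator {0..1} p \<partial>lborel) = ennreal (?F 1 - ?F 0)"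
  proof (rule nn_integral_FTC_Icc)
    fix p :: real
    show "(?F has_real_derivative Bernstein n k p) (at p)"
      using DERIV_cdivide[OF DERIV_minus[OF has_real_derivative_sum_Bernstein[of "Suc n" "Suc k" p]], of "real n + 1"]
      unfolding absorb by (simp add: Bernstein_def mult.assoc)
  qed (auto simp: Bernstein_nonneg)
  have at_1: "(\<Sum>j<Suc k. Bernstein (Suc n) j 1) = 0"
    using assms by (intro sum.neutral) (auto simp: Bernstein_def)
  have at_0: "(\<Sum>j<Suc k. Bernstein (Suc n) j 0) = 1"
    by (subst sum.lessThan_Suc_shift) (simp add: Bernstein_def)
  have "?F 1 - ?F 0 = 1 / (real n + 1)" unfolding at_1 at_0 by simp
  with * show ?thesis by (simp only:)
qed

lemma nn_integral_sum_Bernstein: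
  assumes "k \<le> Suc n"
  shows "(\<integral>\<^sup>+p. ennreal (\<Sum>j<k. Bernstein n j p) * indicator {0..1} p \<partial>lborel) = ennreal (real k / (real n + 1))"
proof -
  have "(\<integral>\<^sup>+p. ennreal (\<Sum>j<k. Bernstein n j p) * indicator {0..1} p \<partial>lborel) =
      (\<integral>\<^sup>+p. (\<Sum>j<k. ennreal (Bernstein n j p) * indicator {0..1} p) \<partial>lborel)"
    by (intro nn_integral_cong) (auto simp: indicator_def sum_ennreal Bernstein_nonneg)
  also have "\<dots> = (\<Sum>j<k. ennreal (1 / (real n + 1)))"
  proof (subst nn_integral_sum)
    show "(\<Sum>j<k. \<integral>\<^sup>+p. ennreal (Bernstein n j p) * indicator {0..1} p \<partial>lborel) =
        (\<Sum>j<k. ennreal (1 / (real n + 1)))"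
      using assms by (intro sum.cong refl nn_integral_Bernstein) auto
  qed measurable
  also have "\<dots> = ennreal (real k / (real n + 1))"
    by (subst sum_ennreal) auto
  finally show ?thesis .
qed

text \<open>Both sides measure the region \<open>0 \<le> s < f x\<close> under the graph of
  \<open>f\<close>, sliced in the two directions; Tonelli's theorem equates them.\<close>

lemma nn_integral_layer_cake:
  fixes f :: "'b \<Rightarrow> real"
  assumes "sigma_finite_measure M" and f [measurable]: "f \<in> borel_measurable M"
    and nonneg: "\<And>x. x \<in> space M \<Longrightarrow> 0 \<le> f x"
  shows "(\<integral>\<^sup>+x. ennreal (f x) \<partial>M) =
    (\<integral>\<^sup>+s. emeasure M {x \<in> space M. s < f x} * indicator {0..} s \<partial>lborel)"
proof -
  interpret sigma_finite_measure M by fact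
  interpret pair_sigma_finite M lborel ..
  have "(\<integral>\<^sup>+x. ennreal (f x) \<partial>M) = (\<integral>\<^sup>+x. (\<integral>\<^sup>+s. indicator {z. 0 \<le> snd z \<and> snd z < f (fst z)} (x, s) \<partial>lborel) \<partial>M)"
  proof (rule nn_integral_cong)
    fix x assume "x \<in> space M"
    have "(\<integral>\<^sup>+s. indicator {z. 0 \<le> snd z \<and> snd z < f (fst z)} (x, s) \<partial>lborel) =
        (\<integral>\<^sup>+s. indicator {0..<f x} s \<partial>lborel)"
      by (intro nn_integral_cong) (auto simp: indicator_def)
    then show "ennreal (f x) = (\<integral>\<^sup>+s. indicator {z. 0 \<le> snd z \<and> snd z < f (fst z)} (x, s) \<partial>lborel)"
      using nonneg[OF \<open>x \<in> space M\<close>] by simp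
  qed
  also have "\<dots> = (\<integral>\<^sup>+s. (\<integral>\<^sup>+x. indicator {z. 0 \<le> snd z \<and> snd z < f (fst z)} (x, s) \<partial>M) \<partial>lborel)"
    by (rule Fubini[symmetric]) measurable
  also have "\<dots> = (\<integral>\<^sup>+s. emeasure M {x \<in> space M. s < f x} * indicator {0..} s \<partial>lborel)"
  proof (rule nn_integral_cong)
    fix s :: real
    have "(\<integral>\<^sup>+x. indicator {z. 0 \<le> snd z \<and> snd z < f (fst z)} (x, s) \<partial>M) =
        (\<integral>\<^sup>+x. indicator {0..} s * indicator {x \<in> space M. s < f x} x \<partial>M)"
      by (intro nn_integral_cong) (auto simp: indicator_def)
    then show "(\<integral>\<^sup>+x. indicator {z. 0 \<le> snd z \<and> snd z < f (fst z)} (x, s) \<partial>M) =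
        emeasure M {x \<in> space M. s < f x} * indicator {0..} s"
      by (simp add: nn_integral_cmult mult.commute)
  qed
  finally show ?thesis .
qed

text \<open>
  Comparing superlevel sets: for antitone \<open>h\<close> each of them is an initial segment of \<open>[0, 1]\<close>,
  where the tail hypothesis applies.
\<close>

lemma nn_integral_antimono_compose_le:
  fixes g :: "'b \<Rightarrow> real" and h :: "real \<Rightarrow> real"
  assumes M: "sigma_finite_measure M" and g [measurable]: "g \<in> borel_measurable M"
    and g01: "\<And>w. w \<in> space M \<Longrightarrow> g w \<in> {0..1}"
    and h [measurable]: "h \<in> borel_measurable borel"
    and h_nonneg: "\<And>p. p \<in> {0..1} \<Longrightarrow> 0 \<le> h p"
    and h_anti: "\<And>p q. 0 \<le> p \<Longrightarrow> p \<le> q \<Longrightarrow> q \<le> 1 \<Longrightarrow> h q \<le> h p"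
    and tail: "\<And>t. t \<in> {0..1} \<Longrightarrow> emeasure M {w \<in> space M. g w \<le> t} \<le> c * ennreal t"
  shows "(\<integral>\<^sup>+w. ennreal (h (g w)) \<partial>M) \<le> c * (\<integral>\<^sup>+p. ennreal (h p) * indicator {0..1} p \<partial>lborel)"
proof -
  \<comment> \<open>Cutting \<open>h\<close> off outside the unit interval keeps its superlevel sets
    at levels \<open>s \<ge> 0\<close> inside that interval.\<close>
  let ?h = "\<lambda>p. h p * indicator {0..1} p"
  have "(\<integral>\<^sup>+w. ennreal (h (g w)) \<partial>M) =
      (\<integral>\<^sup>+s. emeasure M {w \<in> space M. s < h (g w)} * indicator {0..} s \<partial>lborel)"
    using g01 h_nonneg by (intro nn_integral_layer_cake M) auto
  also have "\<dots> \<le> (\<integral>\<^sup>+s. c * (emeasure lborel {p \<in> space lborel. s < ?h p} * indicator {0..} s) \<partial>lborel)"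
  proof (rule nn_integral_mono)
    fix s :: real
    let ?D = "{p \<in> {0..1}. s < h p}"
    have "emeasure M {w \<in> space M. s < h (g w)} \<le> c * emeasure lborel {p. s < ?h p}" if s: "0 \<le> s"
    \<comment> \<open>The empty case is separate because \<open>Sup ?D\<close> is informative only
      for a nonempty set.\<close>
    proof (cases "?D = {}")
      case True
      then have "{w \<in> space M. s < h (g w)} = {}" using g01 by blast
      then show ?thesis by (simp only: emeasure_empty zero_le)
    next
      case False
      have bdd: "bdd_above ?D" by (rule bdd_aboveI[of _ 1]) auto
      let ?t = "Sup ?D"
      obtain d where d: "d \<in> ?D" using False by auto
      have t: "?t \<in> {0..1}"
        using cSup_upper[OF d bdd] d cSup_least[OF False, of 1] by auto
      have "emeasure M {w \<in> space M. s < h (g w)} \<le> emeasure M {w \<in> space M. g w \<le> ?t}"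
        using g01 by (intro emeasure_mono) (auto intro!: cSup_upper bdd)
      also have "\<dots> \<le> c * ennreal ?t" by (rule tail[OF t])
      \<comment> \<open>The supremum need not be attained, but every point of the unit interval
        strictly below it lies below some point of \<open>?D\<close> and so in the superlevel set.
        Dropping the endpoint does not change the length.\<close>
      also have "ennreal ?t = emeasure lborel {0..<?t}" using t by simp
      also have "emeasure lborel {0..<?t} \<le> emeasure lborel {p. s < ?h p}"
      proof (rule emeasure_mono)
        show "{0..<?t} \<subseteq> {p. s < ?h p}"
        proof
          fix p assume p: "p \<in> {0..<?t}"
          then obtain q where q: "q \<in> ?D" "p < q"
            using less_cSup_iff[OF False bdd] by auto
          with p have "h q \<le> h p" by (intro h_anti) auto
          with p q show "p \<in> {p. s < ?h p}" by auto
        qed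
        show "{p. s < ?h p} \<in> sets lborel" by measurable
      qed
      finally show ?thesis by (simp add: mult_left_mono)
    qed
    then show "emeasure M {w \<in> space M. s < h (g w)} * indicator {0..} s \<le>
        c * (emeasure lborel {p \<in> space lborel. s < ?h p} * indicator {0..} s)"
      by (simp add: indicator_def)
  qed
  also have "\<dots> = c * (\<integral>\<^sup>+s. emeasure lborel {p \<in> space lborel. s < ?h p} * indicator {0..} s \<partial>lborel)"
    by (rule nn_integral_cmult) measurable
  also have "(\<integral>\<^sup>+s. emeasure lborel {p \<in> space lborel. s < ?h p} * indicator {0..} s \<partial>lborel) =
      (\<integral>\<^sup>+p. ennreal (?h p) \<partial>lborel)"
    using h_nonneg by (intro nn_integral_layer_cake[symmetric] sigma_finite_lborel) (auto simp: indicator_def)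
  also have "\<dots> = (\<integral>\<^sup>+p. ennreal (h p) * indicator {0..1} p \<partial>lborel)"
    by (intro nn_integral_cong) (auto simp: indicator_def)
  finally show ?thesis .
qed

text \<open>Grouping subsets by size turns a sum over the possible sets of successful draws into a
  binomial sum.\<close>

lemma sum_subsets_card:
  assumes "finite I"
  shows "(\<Sum>J | J \<subseteq> I \<and> card J < k. f (card J)) = (\<Sum>j<k. of_nat (card I choose j) * (f j :: 'c :: comm_semiring_1))"
proof -
  have "(\<Sum>J | J \<subseteq> I \<and> card J < k. f (card J)) =
      (\<Sum>j<k. \<Sum>J\<in>{J \<in> {J. J \<subseteq> I \<and> card J < k}. card J = j}. f (card J))"
    using assms by (intro sum.group[symmetric]) auto
  also have "\<dots> = (\<Sum>j<k. of_nat (card I choose j) * f j)"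
  proof (rule sum.cong[OF refl])
    fix j assume "j \<in> {..<k}"
    then have "{J \<in> {J. J \<subseteq> I \<and> card J < k}. card J = j} = {J. J \<subseteq> I \<and> card J = j}" by auto
    then show "(\<Sum>J\<in>{J \<in> {J. J \<subseteq> I \<and> card J < k}. card J = j}. f (card J)) = of_nat (card I choose j) * f j"
      by (simp add: n_subsets[OF assms])
  qed
  finally show ?thesis .
qed

subsection \<open>The p-value\<close>

theorem theorem1:
  fixes S Q0 :: "'a measure" and T :: "'a \<Rightarrow> real" and P :: "'a \<Rightarrow> 'a measure"
    and m :: nat and M :: "'v measure" and X :: "'v \<Rightarrow> 'a" and Xs :: "nat \<Rightarrow> 'v \<Rightarrow> 'a"
  assumes "standard_borel S"
    and "prob_space Q0" and "sets Q0 = sets S"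
    and "T \<in> borel_measurable S"
    and "P \<in> measurable S (prob_algebra S)"
    and "forward_backward_kernel TYPE('w) TYPE('y) S Q0 P"
    and "m \<ge> 1"
    and "prob_space M"
    and "X \<in> measurable M S" and "distr M S X = Q0"
    and "cond_iid M X S Xs S {1..m}"
    and "\<forall>i\<in>{1..m}. cond_law M X S (Xs i) S P"
  shows "\<forall>\<alpha>\<in>{0..1::real}.
           measure M {w \<in> space M. mc_pvalue T m X Xs w \<le> \<alpha>} \<le> 2 * \<alpha>"
proof
  fix \<alpha> :: real assume \<alpha>: "\<alpha> \<in> {0..1}"
  note T = \<open>T \<in> borel_measurable S\<close> and P = \<open>P \<in> measurable S (prob_algebra S)\<close>
    and M = \<open>prob_space M\<close> and X = \<open>X \<in> measurable M S\<close> and iid = \<open>cond_iid M X S Xs S {1..m}\<close>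
    and law = \<open>\<forall>i\<in>{1..m}. cond_law M X S (Xs i) S P\<close>
  interpret prob_space M by fact
  have Xs: "Xs i \<in> measurable M S" if "i \<in> {1..m}" for i
    using law that by (simp add: cond_law_def)
  \<comment> \<open>For an integer count, \<open>1 + count \<le> \<alpha> * (m + 1)\<close> means
    \<open>count < k\<close>: the 1 in the numerator of the p-value makes the inequality
    strict.\<close>
  define k where "k = nat \<lfloor>\<alpha> * (real m + 1)\<rfloor>"
  have k_le: "real k \<le> \<alpha> * (real m + 1)" using \<alpha> by (simp add: k_def)
  also have "\<dots> \<le> real m + 1" using \<alpha> by (simp add: mult_left_le_one_le)
  \<comment> \<open>The extreme value \<open>m + 1\<close> occurs at \<open>\<alpha> = 1\<close> and
    is still within the range of the Bernstein integral formula.\<close>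
  finally have k_Suc: "k \<le> Suc m" by linarith
  define g where "g x = measure (P x) {y \<in> space S. T x \<le> T y}" for x
  define h where "h p = (\<Sum>j<k. Bernstein m j p)" for p
  have g: "g \<in> borel_measurable S"
    unfolding g_def[abs_def] by (rule measurable_tail_probability[OF T P])
  have PX: "prob_space (P (X w))" "sets (P (X w)) = sets S" if "w \<in> space M" for w
    using measurable_space[OF P measurable_space[OF X that]] by (auto simp: space_prob_algebra)
  have g01: "g (X w) \<in> {0..1}" if "w \<in> space M" for w
    using prob_space.prob_le_1[OF PX(1)[OF that]] by (simp add: g_def)
  let ?N = "S \<Otimes>\<^sub>M S"
  define U where "U = {z \<in> space ?N. T (fst z) \<le> T (snd z)}"
  have U: "U \<in> sets ?N" unfolding U_def using T by measurable
  \<comment> \<open>The complement is used off \<open>J\<close> so that \<open>E J\<close> is the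
    event that \<open>J\<close> is exactly the set of draws with
    \<open>T (X w) \<le> T (Xs i w)\<close>.\<close>
  define B where "B J i = (if i \<in> J then U else space ?N - U)" for J and i :: nat
  define E where "E J = {w \<in> space M. \<forall>i\<in>{1..m}. (X w, Xs i w) \<in> B J i}" for J
  have B: "B J i \<in> sets ?N" for J i using U by (simp add: B_def)
  have E: "E J \<in> sets M" for J
    unfolding E_def
    by (intro sets.sets_Collect_finite_All predE[OF pred_sets2[OF B]] measurable_Pair X Xs) auto
  \<comment> \<open>Conditional independence supplies the product and \<open>cond_law\<close>
    identifies each factor; only finitely many null sets are combined.\<close>
  have joint: "AE w in M. cond_probability M X S {w \<in> space M. \<forall>i\<in>{1..m}. Xs i w \<in> A i} w =
      (\<Prod>i\<in>{1..m}. measure (P (X w)) (A i))" if A: "\<And>i. i \<in> {1..m} \<Longrightarrow> A i \<in> sets S" for A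
  proof -
    have "AE w in M. \<forall>i\<in>{1..m}. cond_probability M X S {w \<in> space M. Xs i w \<in> A i} w = measure (P (X w)) (A i)"
      using law A by (intro AE_finite_allI) (auto simp: cond_law_def)
    moreover have "AE w in M. cond_probability M X S {w \<in> space M. \<forall>i\<in>{1..m}. Xs i w \<in> A i} w =
        (\<Prod>i\<in>{1..m}. cond_probability M X S {w \<in> space M. Xs i w \<in> A i} w)"
      by (rule iid[unfolded cond_iid_def, THEN conjunct2, THEN conjunct2, THEN conjunct2,
            THEN spec[of _ "{1..m}"], THEN mp, OF subset_refl, THEN mp, OF finite_atLeastAtMost, THEN spec, THEN mp])
        (use A in blast)
    ultimately show ?thesis by eventually_elim (auto intro: prod.cong)
  qed
  have emeasure_E: "emeasure M (E J) = (\<integral>\<^sup>+w. ennreal (g (X w) ^ card J * (1 - g (X w)) ^ (m - card J)) \<partial>M)"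
    if J: "J \<subseteq> {1..m}" for J
  proof -
    have "emeasure M (E J) = (\<integral>\<^sup>+w. (\<Prod>i\<in>{1..m}. emeasure (P (X w)) (Pair (X w) -` B J i)) \<partial>M)"
      unfolding E_def by (intro emeasure_cond_product[where S=S and R=S] M X Xs P joint B) auto
    also have "\<dots> = (\<integral>\<^sup>+w. ennreal (g (X w) ^ card J * (1 - g (X w)) ^ (m - card J)) \<partial>M)"
    proof (rule nn_integral_cong)
      fix w assume w: "w \<in> space M"
      interpret P: prob_space "P (X w)" by (rule PX(1)[OF w])
      have Xw: "X w \<in> space S" by (rule measurable_space[OF X w])
      have sp: "space (P (X w)) = space S" by (rule sets_eq_imp_space_eq[OF PX(2)[OF w]])
      have tail: "{y \<in> space S. T (X w) \<le> T y} \<in> sets (P (X w))"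
        unfolding PX(2)[OF w] using T by measurable
      have "Pair (X w) -` U = {y \<in> space S. T (X w) \<le> T y}"
        "Pair (X w) -` (space ?N - U) = space (P (X w)) - {y \<in> space S. T (X w) \<le> T y}"
        using Xw by (auto simp: U_def space_pair_measure sp)
      then have "emeasure (P (X w)) (Pair (X w) -` B J i) = ennreal (if i \<in> J then g (X w) else 1 - g (X w))" for i
        using P.prob_compl[OF tail] by (simp add: B_def g_def P.emeasure_eq_measure)
      then have "(\<Prod>i\<in>{1..m}. emeasure (P (X w)) (Pair (X w) -` B J i)) =
          ennreal (\<Prod>i\<in>{1..m}. if i \<in> J then g (X w) else 1 - g (X w))"
        using g01[OF w] by (simp add: prod_ennreal)
      also have "(\<Prod>i\<in>{1..m}. if i \<in> J then g (X w) else 1 - g (X w)) =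
          (\<Prod>i\<in>J. g (X w)) * (\<Prod>i\<in>{1..m} - J. 1 - g (X w))"
        using J by (simp add: prod.If_cases Int_absorb1 Diff_eq)
      also have "\<dots> = g (X w) ^ card J * (1 - g (X w)) ^ (m - card J)"
        using J by (simp add: card_Diff_subset finite_subset)
      finally show "(\<Prod>i\<in>{1..m}. emeasure (P (X w)) (Pair (X w) -` B J i)) =
          ennreal (g (X w) ^ card J * (1 - g (X w)) ^ (m - card J))" .
    qed
    finally show ?thesis .
  qed
  let ?JJ = "{J. J \<subseteq> {1..m} \<and> card J < k}"
  have finJJ: "finite ?JJ" by (rule finite_subset[of _ "Pow {1..m}"]) auto
  \<comment> \<open>Each outcome lies in \<open>E J\<close> for its own set \<open>J\<close> of
    exceeding draws, and the p-value bound forces \<open>card J < k\<close>.\<close>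
  have "{w \<in> space M. mc_pvalue T m X Xs w \<le> \<alpha>} \<subseteq> (\<Union>J\<in>?JJ. E J)"
  proof
    fix w assume w: "w \<in> {w \<in> space M. mc_pvalue T m X Xs w \<le> \<alpha>}"
    define J where "J = {i \<in> {1..m}. T (X w) \<le> T (Xs i w)}"
    have "(\<Sum>i=1..m. of_bool (T (Xs i w) \<ge> T (X w))) = real (card J)"
      by (simp add: J_def of_bool_def sum.If_cases Int_def)
    with w have "1 + real (card J) \<le> \<alpha> * (real m + 1)"
      by (simp add: mc_pvalue_def divide_le_eq)
    then have "card J < k" unfolding k_def by linarith
    moreover have "w \<in> E J"
      using w measurable_space[OF X] measurable_space[OF Xs]
      by (auto simp: E_def B_def U_def J_def space_pair_measure)
    moreover have "J \<subseteq> {1..m}" by (auto simp: J_def)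
    ultimately show "w \<in> (\<Union>J\<in>?JJ. E J)" by blast
  qed
  then have "emeasure M {w \<in> space M. mc_pvalue T m X Xs w \<le> \<alpha>} \<le> emeasure M (\<Union>J\<in>?JJ. E J)"
    using E finJJ by (intro emeasure_mono) auto
  also have "\<dots> \<le> (\<Sum>J\<in>?JJ. emeasure M (E J))"
    using E by (intro emeasure_subadditive_finite finJJ) auto
  also have "\<dots> = (\<Sum>J\<in>?JJ. \<integral>\<^sup>+w. ennreal (g (X w) ^ card J * (1 - g (X w)) ^ (m - card J)) \<partial>M)"
    by (intro sum.cong refl emeasure_E) auto
  also have "\<dots> = (\<integral>\<^sup>+w. (\<Sum>J\<in>?JJ. ennreal (g (X w) ^ card J * (1 - g (X w)) ^ (m - card J))) \<partial>M)"
    using measurable_compose[OF X g] by (intro nn_integral_sum[symmetric]) auto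
  also have "\<dots> = (\<integral>\<^sup>+w. ennreal (h (g (X w))) \<partial>M)"
  \<comment> \<open>Summing the probabilities of the exact patterns \<open>J\<close> by size gives
    the lower tail of a binomial with success probability \<open>g (X w)\<close>.\<close>
  proof (rule nn_integral_cong)
    fix w assume w: "w \<in> space M"
    show "(\<Sum>J\<in>?JJ. ennreal (g (X w) ^ card J * (1 - g (X w)) ^ (m - card J))) = ennreal (h (g (X w)))"
      using g01[OF w] sum_subsets_card[of "{1..m}" "\<lambda>j. g (X w) ^ j * (1 - g (X w)) ^ (m - j)" k]
      by (simp add: h_def Bernstein_def sum_ennreal mult.assoc)
  qed
  \<comment> \<open>The tail bound says that \<open>g (X w)\<close> puts at most twice the uniform
    mass on each initial segment of the unit interval; since \<open>h\<close> is antitone, its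
    expectation is at most twice the uniform one.\<close>
  also have "\<dots> \<le> 2 * (\<integral>\<^sup>+p. ennreal (h p) * indicator {0..1} p \<partial>lborel)"
  proof (rule nn_integral_antimono_compose_le)
    show "sigma_finite_measure M" by unfold_locales
    show "(\<lambda>w. g (X w)) \<in> borel_measurable M" by (rule measurable_compose[OF X g])
    show "h \<in> borel_measurable borel" unfolding h_def[abs_def] by measurable
    show "0 \<le> h p" if "p \<in> {0..1}" for p
      using that by (auto simp: h_def intro!: sum_nonneg Bernstein_nonneg)
    show "h q \<le> h p" if "0 \<le> p" "p \<le> q" "q \<le> 1" for p q
      unfolding h_def by (rule sum_Bernstein_antimono[OF that])
    fix t :: real assume t: "t \<in> {0..1}"
    have "{x \<in> space S. g x \<le> t} \<in> sets S" using g by measurable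
    then have "measure M {w \<in> space M. g (X w) \<le> t} = measure Q0 {x \<in> space S. g x \<le> t}"
      unfolding \<open>distr M S X = Q0\<close>[symmetric] using measurable_space[OF X]
      by (subst measure_distr[OF X]) (auto intro!: arg_cong[where f="measure M"])
    also have "\<dots> \<le> 2 * t"
      unfolding g_def using \<open>forward_backward_kernel TYPE('w) TYPE('y) S Q0 P\<close> T P t
      by (intro forward_backward_tail_bound) auto
    finally have "ennreal (measure M {w \<in> space M. g (X w) \<le> t}) \<le> ennreal (2 * t)"
      by (rule ennreal_leI)
    then show "emeasure M {w \<in> space M. g (X w) \<le> t} \<le> 2 * ennreal t"
      using t by (simp add: emeasure_eq_measure ennreal_mult)
  qed (rule g01)
  also have "\<dots> = ennreal (2 * (real k / (real m + 1)))"
    unfolding h_def nn_integral_sum_Bernstein[OF k_Suc] by (subst ennreal_mult) auto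
  finally have "measure M {w \<in> space M. mc_pvalue T m X Xs w \<le> \<alpha>} \<le> 2 * (real k / (real m + 1))"
    by (simp add: emeasure_eq_measure)
  also have "\<dots> \<le> 2 * \<alpha>" using k_le by (simp add: divide_le_eq)
  finally show "measure M {w \<in> space M. mc_pvalue T m X Xs w \<le> \<alpha>} \<le> 2 * \<alpha>" .
qed

end
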